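(* Let $\mathcal A$ be an associative ternary algebra over $\mathbb C$, i.e. a complex vector space with a trilinear product $(a,b,c)\mapsto a\cdot b\cdot c$ that is associative either of the first kind or of the second kind. Then for any five elements $a_1,a_2,a_3,a_4,a_5\in\mathcal A$, $$\Omega(a_1,a_2,a_3,a_4,a_5):=\sum_{\rho\in GA(1,5)}\big[[a_{\rho(1)},a_{\rho(2)},a_{\rho(3)}],a_{\rho(4)},a_{\rho(5)}\big]=0,$$ where $[-,-,-]$ is the ternary $\omega$-commutator of $\mathcal A$.
   Context: Let $\omega\in\mathbb C$ be a primitive cube root of unity and $\bar\omega=\omega^2$ its complex conjugate, so $1+\omega+\bar\omega=0$. A ternary algebra is a complex vector space $\mathcal A$ with a trilinear map $\mathcal A\times\mathcal A\times\mathcal A\to\mathcal A$, $(a,b,c)\mapsto a\cdot b\cdot c$. It is associative of the first kind if for all $a,b,c,g,h\in\mathcal A$ $$(a\cdot b\cdot c)\cdot g\cdot h=a\cdot(b\cdot c\cdot g)\cdot h=a\cdot b\cdot(c\cdot g\cdot h),$$ and associative of the second kind if for all $a,b,c,g,h\in\mathcal A$ $$(a\cdot b\cdot c)\cdot g\cdot h=a\cdot(g\cdot c\cdot b)\cdot h=a\cdot b\cdot(c\cdot g\cdot h).$$ An associative ternary algebra is a ternary algebra that is associative of the first kind or of the second kind. The ternary $\omega$-commutator is $$[a,b,c]=a\cdot b\cdot c+\omega\, b\cdot c\cdot a+\bar\omega\, c\cdot a\cdot b+c\cdot b\cdot a+\bar\omega\, b\cdot a\cdot c+\omega\, a\cdot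 c\cdot b .$$ $GA(1,5)$ denotes the general affine group of degree one over $\mathbb F_5$ (order 20), regarded as the subgroup of the symmetric group $S_5$ on $\{1,2,3,4,5\}$ generated by the cycles $\sigma=(1\;2\;3\;4\;5)$ and $\tau=(2\;4\;5\;3)$. Explicitly, writing $$\circlearrowleft\big[[x_1,x_2,x_3],x_4,x_5\big]=\big[[x_1,x_2,x_3],x_4,x_5\big]+\big[[x_2,x_3,x_4],x_5,x_1\big]+\big[[x_3,x_4,x_5],x_1,x_2\big]+\big[[x_4,x_5,x_1],x_2,x_3\big]+\big[[x_5,x_1,x_2],x_3,x_4\big],$$ extended additively to sums of double brackets, one has $$\Omega(a_1,\dots,a_5)=\circlearrowleft\Big(\big[[a_1,a_2,a_3],a_4,a_5\big]+\big[[a_1,a_4,a_2],a_5,a_3\big]+\big[[a_1,a_5,a_4],a_3,a_2\big]+\big[[a_1,a_3,a_5],a_2,a_4\big]\Big).$$ *)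

theory Defs
  imports Complex_Main "HOL-Algebra.Sym_Groups" "HOL-Combinatorics.Cycles"
begin

definition primitive_root_of_unity :: "nat \<Rightarrow> complex \<Rightarrow> bool" where
  "primitive_root_of_unity n z \<longleftrightarrow> n > 0 \<and> z ^ n = 1 \<and> (\<forall>k. 0 < k \<and> k < n \<longrightarrow> z ^ k \<noteq> 1)"

locale ternary_algebra = vector_space scale
  for scale :: "complex \<Rightarrow> 'a::ab_group_add \<Rightarrow> 'a" +
  fixes tprod :: "'a \<Rightarrow> 'a \<Rightarrow> 'a \<Rightarrow> 'a"
  assumes linear_fst: "Vector_Spaces.linear scale scale (\<lambda>a. tprod a b c)"
    and linear_snd: "Vector_Spaces.linear scale scale (\<lambda>b. tprod a b c)"
    and linear_trd: "Vector_Spaces.linear scale scale (\<lambda>c. tprod a b c)"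

definition assoc_first_kind :: "('a \<Rightarrow> 'a \<Rightarrow> 'a \<Rightarrow> 'a) \<Rightarrow> bool" where
  "assoc_first_kind t \<longleftrightarrow> (\<forall>a b c g h.
     t (t a b c) g h = t a (t b c g) h \<and> t a (t b c g) h = t a b (t c g h))"

definition assoc_second_kind :: "('a \<Rightarrow> 'a \<Rightarrow> 'a \<Rightarrow> 'a) \<Rightarrow> bool" where
  "assoc_second_kind t \<longleftrightarrow> (\<forall>a b c g h.
     t (t a b c) g h = t a (t g c b) h \<and> t a (t g c b) h = t a b (t c g h))"

locale associative_ternary_algebra = ternary_algebra +
  assumes assoc: "assoc_first_kind tprod \<or> assoc_second_kind tprod"

definition omega_commutator ::
  "(complex \<Rightarrow> 'a::ab_group_add \<Rightarrow> 'a) \<Rightarrow> ('a \<Rightarrow> 'a \<Rightarrow> 'a \<Rightarrow> 'a) \<Rightarrow> complex \<Rightarrow> 'a \<Rightarrow> 'a \<Rightarrow> 'a \<Rightarrow> 'a" where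
  "omega_commutator scale t \<omega> a b c =
     t a b c + scale \<omega> (t b c a) + scale (cnj \<omega>) (t c a b)
     + t c b a + scale (cnj \<omega>) (t b a c) + scale \<omega> (t a c b)"

definition ga_sigma :: "nat \<Rightarrow> nat" where
  "ga_sigma = cycle_of_list [1, 2, 3, 4, 5]"

definition ga_tau :: "nat \<Rightarrow> nat" where
  "ga_tau = cycle_of_list [2, 4, 5, 3]"

definition GA_1_5 :: "(nat \<Rightarrow> nat) set" where
  "GA_1_5 = generate (sym_group 5) {ga_sigma, ga_tau}"

definition double_bracket :: "('a \<Rightarrow> 'a \<Rightarrow> 'a \<Rightarrow> 'a) \<Rightarrow> 'a \<Rightarrow> 'a \<Rightarrow> 'a \<Rightarrow> 'a \<Rightarrow> 'a \<Rightarrow> 'a" where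
  "double_bracket br x1 x2 x3 x4 x5 = br (br x1 x2 x3) x4 x5"

text \<open>Only the values \<open>a 1, \<dots>, a 5\<close> matter, since the elements of \<^const>\<open>GA_1_5\<close> permute
  \<open>{1..5}\<close>.\<close>

definition Omega :: "('a::ab_group_add \<Rightarrow> 'a \<Rightarrow> 'a \<Rightarrow> 'a) \<Rightarrow> (nat \<Rightarrow> 'a) \<Rightarrow> 'a" where
  "Omega br a =
     (\<Sum>\<rho>\<in>GA_1_5. double_bracket br (a (\<rho> 1)) (a (\<rho> 2)) (a (\<rho> 3)) (a (\<rho> 4)) (a (\<rho> 5)))"

text \<open>The rest of the theory checks that \<^const>\<open>GA_1_5\<close> has order 20 (so that the sum above is
  a genuine finite sum) and that \<^const>\<open>Omega\<close> has the expected explicit form.\<close>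

definition cyclic_sum :: "('a \<Rightarrow> 'a \<Rightarrow> 'a \<Rightarrow> 'a \<Rightarrow> 'a \<Rightarrow> 'b::ab_group_add) \<Rightarrow> 'a \<Rightarrow> 'a \<Rightarrow> 'a \<Rightarrow> 'a \<Rightarrow> 'a \<Rightarrow> 'b"
  where "cyclic_sum f x1 x2 x3 x4 x5 =
    f x1 x2 x3 x4 x5 + f x2 x3 x4 x5 x1 + f x3 x4 x5 x1 x2 + f x4 x5 x1 x2 x3 + f x5 x1 x2 x3 x4"

lemma funpow_one: "f ^^ 1 = f" for f :: "'a \<Rightarrow> 'a"
  by simp

lemma funpow_small:
  "f ^^ 2 = f \<circ> f" "f ^^ 3 = f \<circ> (f \<circ> f)" "f ^^ 4 = f \<circ> (f \<circ> (f \<circ> f))"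
  for f :: "'a \<Rightarrow> 'a"
  by (simp_all add: numeral_eq_Suc)

lemma ga_sigma_simps:
  "ga_sigma (Suc 0) = 2" "ga_sigma 2 = 3" "ga_sigma 3 = 4" "ga_sigma 4 = 5" "ga_sigma 5 = Suc 0"
  by (simp_all add: ga_sigma_def transpose_def)

lemma ga_tau_simps:
  "ga_tau (Suc 0) = Suc 0" "ga_tau 2 = 4" "ga_tau 4 = 5" "ga_tau 5 = 3" "ga_tau 3 = 2"
  by (simp_all add: ga_tau_def transpose_def)

lemma ga_sigma_5: "ga_sigma ^^ 5 = id"
proof -
  have "ga_sigma ^^ length [1, 2, 3, 4, 5::nat] = id"
    unfolding ga_sigma_def by (rule cycle_is_id_root) simp
  moreover have "length [1, 2, 3, 4, 5::nat] = 5" by simp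
  ultimately show ?thesis by (simp only:)
qed

lemma ga_tau_4: "ga_tau ^^ 4 = id"
proof -
  have "ga_tau ^^ length [2, 4, 5, 3::nat] = id"
    unfolding ga_tau_def by (rule cycle_is_id_root) simp
  moreover have "length [2, 4, 5, 3::nat] = 4" by simp
  ultimately show ?thesis by (simp only:)
qed

lemma ga_permutes:
  "ga_sigma permutes {1..5}" "ga_tau permutes {1..5}"
proof -
  show "ga_sigma permutes {1..5}"
    unfolding ga_sigma_def by (rule permutes_subset[OF cycle_permutes]) auto
  show "ga_tau permutes {1..5}"
    unfolding ga_tau_def by (rule permutes_subset[OF cycle_permutes]) auto
qed

lemma ga_sigma_tau: "ga_sigma \<circ> ga_tau = ga_tau \<circ> ga_sigma ^^ 2"
proof
  fix x :: nat
  consider "x \<in> {Suc 0, 2, 3, 4, 5}" | "x \<notin> {1..5}" by fastforce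
  then show "(ga_sigma \<circ> ga_tau) x = (ga_tau \<circ> ga_sigma ^^ 2) x"
  proof cases
    case 1
    then show ?thesis by (auto simp: ga_sigma_simps ga_tau_simps funpow_small)
  next
    case 2
    then show ?thesis by (simp add: permutes_not_in[OF ga_permutes(1)] permutes_not_in[OF ga_permutes(2)]
          funpow_small del: atLeastAtMost_iff)
  qed
qed

lemma ga_sigma_pow_tau: "ga_sigma ^^ k \<circ> ga_tau = ga_tau \<circ> ga_sigma ^^ (2 * k)"
proof (induction k)
  case 0
  then show ?case by simp
next
  case (Suc k)
  have "ga_sigma ^^ Suc k \<circ> ga_tau = ga_sigma \<circ> (ga_sigma ^^ k \<circ> ga_tau)"
    by (simp only: funpow.simps comp_assoc)
  also have "\<dots> = (ga_sigma \<circ> ga_tau) \<circ> ga_sigma ^^ (2 * k)"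
    unfolding Suc.IH by (simp only: comp_assoc)
  also have "\<dots> = ga_tau \<circ> ga_sigma ^^ (2 + 2 * k)"
    unfolding ga_sigma_tau by (simp only: comp_assoc funpow_add)
  finally show ?case by (simp only: mult_Suc_right)
qed

lemma ga_sigma_pow_tau_pow: "\<exists>m. ga_sigma ^^ k \<circ> ga_tau ^^ c = ga_tau ^^ c \<circ> ga_sigma ^^ m"
proof (induction c arbitrary: k)
  case 0
  then show ?case by auto
next
  case (Suc c)
  obtain m where m: "ga_sigma ^^ (2 * k) \<circ> ga_tau ^^ c = ga_tau ^^ c \<circ> ga_sigma ^^ m"
    using Suc.IH by blast
  have "ga_sigma ^^ k \<circ> ga_tau ^^ Suc c = (ga_sigma ^^ k \<circ> ga_tau) \<circ> ga_tau ^^ c"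
    by (simp only: funpow.simps comp_assoc)
  also have "\<dots> = ga_tau \<circ> (ga_sigma ^^ (2 * k) \<circ> ga_tau ^^ c)"
    unfolding ga_sigma_pow_tau by (simp only: comp_assoc)
  also have "\<dots> = ga_tau ^^ Suc c \<circ> ga_sigma ^^ m"
    unfolding m by (simp only: funpow.simps comp_assoc)
  finally show ?case by blast
qed

lemma GA_1_5_mult: "p \<in> GA_1_5 \<Longrightarrow> q \<in> GA_1_5 \<Longrightarrow> p \<circ> q \<in> GA_1_5"
  unfolding GA_1_5_def using generate.eng[of _ "sym_group 5"] by (simp add: sym_group_mult)

lemma GA_1_5_pow: "p \<in> GA_1_5 \<Longrightarrow> p ^^ k \<in> GA_1_5"
proof (induction k)
  case 0
  then show ?case
    unfolding GA_1_5_def using generate.one[of "sym_group 5"]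
    by (simp only: funpow.simps sym_group_one)
next
  case (Suc k)
  then show ?case by (simp only: funpow.simps GA_1_5_mult)
qed

lemma GA_1_5_inv:
  assumes "p permutes {1..5}" "p \<circ> p ^^ k = id"
  shows "inv\<^bsub>sym_group 5\<^esub> p = p ^^ k"
proof -
  interpret group "sym_group 5" by (rule sym_group_is_group)
  have "p ^^ k permutes {1..5}" using assms(1) by (rule permutes_funpow)
  moreover have "p ^^ k \<circ> p = id" using assms(2) by (simp add: fun_eq_iff funpow_swap1)
  ultimately show ?thesis
    using assms(1) by (intro inv_equality) (simp_all add: sym_group_carrier sym_group_mult sym_group_one)
qed

lemma GA_1_5_eq:
  "GA_1_5 = (\<lambda>(c, k). ga_tau ^^ c \<circ> ga_sigma ^^ k) ` ({..<4} \<times> {..<5})" (is "_ = ?E")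
proof
  have reduce: "ga_tau ^^ c \<circ> ga_sigma ^^ k \<in> ?E" for c k
  proof -
    have "ga_tau ^^ c = ga_tau ^^ (c mod 4)" "ga_sigma ^^ k = ga_sigma ^^ (k mod 5)"
      by (simp_all add: fun_eq_iff funpow_mod_eq ga_tau_4 ga_sigma_5)
    then have "ga_tau ^^ c \<circ> ga_sigma ^^ k = ga_tau ^^ (c mod 4) \<circ> ga_sigma ^^ (k mod 5)"
      by (simp only:)
    then show ?thesis by (intro image_eqI[of _ _ "(c mod 4, k mod 5)"]) simp_all
  qed
  have closed: "p \<circ> q \<in> ?E" if "p \<in> ?E" "q \<in> ?E" for p q
  proof -
    obtain c k where p: "p = ga_tau ^^ c \<circ> ga_sigma ^^ k"
      using \<open>p \<in> ?E\<close> by (elim imageE) auto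
    obtain d l where q: "q = ga_tau ^^ d \<circ> ga_sigma ^^ l"
      using \<open>q \<in> ?E\<close> by (elim imageE) auto
    obtain m where m: "ga_sigma ^^ k \<circ> ga_tau ^^ d = ga_tau ^^ d \<circ> ga_sigma ^^ m"
      using ga_sigma_pow_tau_pow by blast
    have "p \<circ> q = ga_tau ^^ c \<circ> (ga_sigma ^^ k \<circ> ga_tau ^^ d) \<circ> ga_sigma ^^ l"
      unfolding p q by (simp only: comp_assoc)
    also have "\<dots> = ga_tau ^^ (c + d) \<circ> ga_sigma ^^ (m + l)"
      unfolding m by (simp only: comp_assoc funpow_add)
    finally show ?thesis by (simp only: reduce)
  qed
  have "ga_sigma \<circ> ga_sigma ^^ 4 = ga_sigma ^^ (1 + 4)" "ga_tau \<circ> ga_tau ^^ 3 = ga_tau ^^ (1 + 3)"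
    by (simp_all only: funpow_add funpow_one)
  then have "ga_sigma \<circ> ga_sigma ^^ 4 = id" "ga_tau \<circ> ga_tau ^^ 3 = id"
    by (simp_all add: ga_sigma_5 ga_tau_4)
  then have invs: "inv\<^bsub>sym_group 5\<^esub> ga_sigma = ga_sigma ^^ 4" "inv\<^bsub>sym_group 5\<^esub> ga_tau = ga_tau ^^ 3"
    by (simp_all only: GA_1_5_inv ga_permutes)
  show "GA_1_5 \<subseteq> ?E"
  proof
    fix p assume "p \<in> GA_1_5"
    then show "p \<in> ?E" unfolding GA_1_5_def
    proof (induction rule: generate.induct)
      case one
      then show ?case using reduce[of 0 0] by (simp only: sym_group_one funpow.simps comp_id)
    next
      case (incl h)
      then show ?case using reduce[of 0 1] reduce[of 1 0]
        by (elim insertE) (simp_all only: funpow_one funpow.simps(1) comp_id id_comp empty_iff)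
    next
      case (inv h)
      then show ?case using reduce[of 0 4] reduce[of 3 0] invs
        by (elim insertE) (simp_all only: funpow.simps(1) comp_id id_comp empty_iff)
    next
      case (eng h1 h2)
      then show ?case using closed by (simp only: sym_group_mult)
    qed
  qed
  have "ga_sigma \<in> GA_1_5" "ga_tau \<in> GA_1_5"
    unfolding GA_1_5_def by (auto intro: generate.incl)
  then show "?E \<subseteq> GA_1_5"
    by (auto intro!: GA_1_5_mult GA_1_5_pow)
qed

lemma GA_1_5_index: "{..<4} \<times> {..<5} = set (List.product [0, 1, 2, 3::nat] [0, 1, 2, 3, 4::nat])"
proof -
  have "{..<4} = set [0, 1, 2, 3::nat]" "{..<5} = set [0, 1, 2, 3, 4::nat]" by auto
  then show ?thesis by (simp only: set_product)
qed

lemma GA_1_5_inj: "inj_on (\<lambda>(c, k). ga_tau ^^ c \<circ> ga_sigma ^^ k) ({..<4} \<times> {..<5})"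
proof -
  let ?f = "\<lambda>(c, k). ((ga_tau ^^ c \<circ> ga_sigma ^^ k) 1, (ga_tau ^^ c \<circ> ga_sigma ^^ k) 2)"
  have "distinct (map ?f (List.product [0, 1, 2, 3] [0, 1, 2, 3, 4]))"
    by (simp add: funpow_small ga_sigma_simps ga_tau_simps)
  then have "inj_on ?f ({..<4} \<times> {..<5})"
    unfolding GA_1_5_index distinct_map by blast
  then have "inj_on ((\<lambda>p. (p 1, p 2)) \<circ> (\<lambda>(c, k). ga_tau ^^ c \<circ> ga_sigma ^^ k)) ({..<4} \<times> {..<5})"
    by (simp only: comp_def case_prod_unfold)
  then show ?thesis by (rule inj_on_imageI2)
qed

lemma finite_GA_1_5: "finite GA_1_5"
  unfolding GA_1_5_eq by simp

lemma card_GA_1_5: "card GA_1_5 = 20"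
  unfolding GA_1_5_eq card_image[OF GA_1_5_inj] by (simp add: card_cartesian_product)

lemma Omega_explicit:
  "Omega br a =
     cyclic_sum (double_bracket br) (a 1) (a 2) (a 3) (a 4) (a 5)
     + cyclic_sum (double_bracket br) (a 1) (a 4) (a 2) (a 5) (a 3)
     + cyclic_sum (double_bracket br) (a 1) (a 5) (a 4) (a 3) (a 2)
     + cyclic_sum (double_bracket br) (a 1) (a 3) (a 5) (a 2) (a 4)"
proof -
  have d: "distinct (List.product [0, 1, 2, 3] [0, 1, 2, 3, 4::nat] :: (nat \<times> nat) list)"
    by simp
  show ?thesis
    unfolding Omega_def GA_1_5_eq sum.reindex[OF GA_1_5_inj] cyclic_sum_def
    unfolding GA_1_5_index sum.distinct_set_conv_list[OF d]
    by (simp add: funpow_small ga_sigma_simps ga_tau_simps add.assoc)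
qed

end

theory Submission
  imports Defs
begin

text \<open>Associativity writes every iterated product as a word in five letters, so \<open>\<Omega>\<close> is a
  combination of 36 sums \<open>\<Sum>\<rho>. W (a (\<rho> i)) (a (\<rho> j)) (a (\<rho> k)) (a (\<rho> l)) (a (\<rho> m))\<close>. Such a sum only
  depends on the orbit of \<open>(i, j, k, l, m)\<close> under \<open>GA(1,5)\<close>. As \<open>GA(1,5)\<close> is sharply 2-transitive, each
  of the six orbits contains a unique tuple beginning with \<open>1, 2\<close>, and in every orbit
  the coefficients add up to a multiple of \<open>1 + \<omega> + \<omega>\<^sup>2 = 0\<close>.\<close>

text \<open>Both \<open>cnj \<omega>\<close> and \<open>\<omega> * \<omega>\<close> are inverse to
  \<open>\<omega>\<close>, since its modulus is 1. The first three rules multiply coefficients of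
  nested brackets.\<close>

lemma primitive_cube_root_of_unity:
  assumes "primitive_root_of_unity 3 \<omega>"
  shows "\<omega> * \<omega> = cnj \<omega>" "\<omega> * cnj \<omega> = 1" "cnj \<omega> * cnj \<omega> = \<omega>" "cnj \<omega> = - 1 - \<omega>"
proof -
  have cube: "\<omega> ^ 3 = 1" and ne: "\<omega> \<noteq> 1"
    using assms by (auto simp: primitive_root_of_unity_def dest: spec[of _ 1])
  have "(\<omega> - 1) * (\<omega> * \<omega> + \<omega> + 1) = \<omega> ^ 3 - 1"
    by (simp add: algebra_simps power3_eq_cube)
  then have "\<omega> * \<omega> + \<omega> + 1 = 0" using cube ne by simp
  then have sq: "\<omega> * \<omega> = - 1 - \<omega>"
    by (simp add: algebra_simps eq_neg_iff_add_eq_0)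
  have "cmod \<omega> ^ 3 = 1" using cube by (metis norm_one norm_power)
  then have "cmod \<omega> = 1" using power_eq_imp_eq_base[of "cmod \<omega>" 3 1] by simp
  then show inverse: "\<omega> * cnj \<omega> = 1" by (simp add: complex_norm_square[symmetric])
  have "\<omega> * (\<omega> * \<omega>) = 1" using cube by (simp add: power3_eq_cube mult.assoc)
  then have "\<omega> * cnj \<omega> = \<omega> * (\<omega> * \<omega>)" using inverse by simp
  moreover have "\<omega> \<noteq> 0" using inverse by auto
  ultimately show conj: "\<omega> * \<omega> = cnj \<omega>" by (metis mult_left_cancel)
  then show "cnj \<omega> = - 1 - \<omega>" using sq by simp
  show "cnj \<omega> * cnj \<omega> = \<omega>" by (metis conj complex_cnj_cnj complex_cnj_mult)
qed

lemma GA_1_5_generators: "ga_sigma \<in> GA_1_5" "ga_tau \<in> GA_1_5"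
  unfolding GA_1_5_def by (auto intro: generate.incl)

text \<open>As \<open>g\<close> is surjective, composing with it on the right is injective, hence
  permutes the finite set \<open>GA_1_5\<close>.\<close>

lemma sum_GA_1_5_comp:
  assumes "g \<in> GA_1_5"
  shows "(\<Sum>\<rho>\<in>GA_1_5. F (\<rho> \<circ> g)) = (\<Sum>\<rho>\<in>GA_1_5. F \<rho>)"
proof -
  have "g permutes {1..5}"
    using assms group.generate_incl[OF sym_group_is_group, of "{ga_sigma, ga_tau}" 5] ga_permutes
    by (auto simp: GA_1_5_def sym_group_carrier)
  then have inj: "inj_on (\<lambda>\<rho>. \<rho> \<circ> g) GA_1_5"
    by (auto intro!: inj_onI simp: fun_eq_iff) (metis permutes_surj surjD)
  have "(\<lambda>\<rho>. \<rho> \<circ> g) ` GA_1_5 = GA_1_5"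
    using assms by (intro endo_inj_surj finite_GA_1_5 inj) (auto intro: GA_1_5_mult)
  then show ?thesis
    using sum.reindex[OF inj, of F] by simp
qed

text \<open>Keeping the five positions as arguments turns invariance under the group into rewriting
  of indices.\<close>

definition orbit_sum ::
    "('a \<Rightarrow> 'a \<Rightarrow> 'a \<Rightarrow> 'a \<Rightarrow> 'a \<Rightarrow> 'b::comm_monoid_add) \<Rightarrow> (nat \<Rightarrow> 'a) \<Rightarrow>
      nat \<Rightarrow> nat \<Rightarrow> nat \<Rightarrow> nat \<Rightarrow> nat \<Rightarrow> 'b" where
  "orbit_sum W a i j k l m =
     (\<Sum>\<rho>\<in>GA_1_5. W (a (\<rho> i)) (a (\<rho> j)) (a (\<rho> k)) (a (\<rho> l)) (a (\<rho> m)))"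

lemma orbit_sum_translate:
  assumes "g \<in> GA_1_5"
  shows "orbit_sum W a i j k l m = orbit_sum W a (g i) (g j) (g k) (g l) (g m)"
  using sum_GA_1_5_comp[OF assms, of "\<lambda>\<rho>. W (a (\<rho> i)) (a (\<rho> j)) (a (\<rho> k)) (a (\<rho> l)) (a (\<rho> m))"]
  by (simp add: orbit_sum_def)

text \<open>Rewriting to the representative that begins with \<open>1, 2\<close>: \<^const>\<open>ga_sigma\<close> moves the first index
  to \<open>1\<close>, and \<^const>\<open>ga_tau\<close>, which fixes \<open>1\<close>, then moves the second one to \<open>2\<close>.\<close>

lemma orbit_sum_normalize:
  "orbit_sum W a 2 j k l m = orbit_sum W a 3 (ga_sigma j) (ga_sigma k) (ga_sigma l) (ga_sigma m)"
  "orbit_sum W a 3 j k l m = orbit_sum W a 4 (ga_sigma j) (ga_sigma k) (ga_sigma l) (ga_sigma m)"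
  "orbit_sum W a 4 j k l m = orbit_sum W a 5 (ga_sigma j) (ga_sigma k) (ga_sigma l) (ga_sigma m)"
  "orbit_sum W a 5 j k l m = orbit_sum W a (Suc 0) (ga_sigma j) (ga_sigma k) (ga_sigma l) (ga_sigma m)"
  "orbit_sum W a (Suc 0) 4 k l m = orbit_sum W a (Suc 0) 5 (ga_tau k) (ga_tau l) (ga_tau m)"
  "orbit_sum W a (Suc 0) 5 k l m = orbit_sum W a (Suc 0) 3 (ga_tau k) (ga_tau l) (ga_tau m)"
  "orbit_sum W a (Suc 0) 3 k l m = orbit_sum W a (Suc 0) 2 (ga_tau k) (ga_tau l) (ga_tau m)"
  using orbit_sum_translate[OF GA_1_5_generators(1), where W = W and a = a]
    orbit_sum_translate[OF GA_1_5_generators(2), where W = W and a = a and i = "Suc 0"]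
  by (metis ga_sigma_simps ga_tau_simps)+

context ternary_algebra
begin

lemma tprod_add:
  "tprod (x + y) b c = tprod x b c + tprod y b c"
  "tprod b (x + y) c = tprod b x c + tprod b y c"
  "tprod b c (x + y) = tprod b c x + tprod b c y"
  using linear_fst linear_snd linear_trd by (simp_all add: Vector_Spaces.linear_iff)

lemma tprod_scale:
  "tprod (scale r x) b c = scale r (tprod x b c)"
  "tprod b (scale r x) c = scale r (tprod b x c)"
  "tprod b c (scale r x) = scale r (tprod b c x)"
  using linear_fst linear_snd linear_trd by (simp_all add: Vector_Spaces.linear_iff)

text \<open>The two cases of \<open>middle\<close> are the two kinds of associativity; the second
  reverses the inner three letters.\<close>

lemma Omega_omega_commutator:
  assumes \<omega>: "primitive_root_of_unity 3 \<omega>"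
    and left: "\<And>a b c g h. tprod (tprod a b c) g h = W a b c g h"
    and right: "\<And>a b c g h. tprod a b (tprod c g h) = W a b c g h"
    and middle: "(\<forall>a b c g h. tprod a (tprod b c g) h = W a b c g h) \<or>
      (\<forall>a b c g h. tprod a (tprod b c g) h = W a g c b h)"
  shows "Omega (omega_commutator scale tprod \<omega>) a = 0"
proof -
  note expand = Omega_def double_bracket_def omega_commutator_def tprod_add tprod_scale left right
    sum.distrib scale_sum_right[symmetric] scale_right_distrib orbit_sum_def[symmetric]
  note normalize = orbit_sum_normalize ga_sigma_simps ga_tau_simps
  \<comment> \<open>Only the coefficients 1 and \<open>\<omega>\<close> remain, so that the
    cancellation becomes visible.\<close>
  have cnj: "scale (cnj \<omega>) v = - v - scale \<omega> v" for v
    by (simp add: primitive_cube_root_of_unity(4)[OF \<omega>] scale_left_diff_distrib)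
  note products = primitive_cube_root_of_unity(1-3)[OF \<omega>]
    primitive_cube_root_of_unity(2)[OF \<omega>, unfolded mult.commute[of \<omega>]]
  \<comment> \<open>Expand under the sum into orbit sums, move each to its representative while
    multiplying coefficients, and only then eliminate \<open>cnj \<omega>\<close>, which the product
    rules mention.\<close>
  from middle show ?thesis
    by (elim disjE) (simp_all add: expand, simp_all add: normalize products, simp_all add: cnj)
qed

end

theorem theorem1:
  fixes scale :: "complex \<Rightarrow> 'a::ab_group_add \<Rightarrow> 'a"
    and tprod :: "'a \<Rightarrow> 'a \<Rightarrow> 'a \<Rightarrow> 'a"
    and \<omega> :: complex
    and a :: "nat \<Rightarrow> 'a"
  assumes "primitive_root_of_unity 3 \<omega>"
    and "associative_ternary_algebra scale tprod"
  shows "Omega (omega_commutator scale tprod \<omega>) a = 0"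
proof -
  interpret associative_ternary_algebra scale tprod by fact
  show ?thesis
  proof (rule Omega_omega_commutator[OF assms(1), where W = "\<lambda>a b c g h. tprod (tprod a b c) g h"])
    show "tprod a b (tprod c g h) = tprod (tprod a b c) g h" for a b c g h
      using assoc by (auto simp: assoc_first_kind_def assoc_second_kind_def)
    \<comment> \<open>The second alternative is the law of the second kind with \<open>b\<close> and
      \<open>g\<close> exchanged.\<close>
    show "(\<forall>a b c g h. tprod a (tprod b c g) h = tprod (tprod a b c) g h) \<or>
      (\<forall>a b c g h. tprod a (tprod b c g) h = tprod (tprod a g c) b h)"
      using assoc unfolding assoc_first_kind_def assoc_second_kind_def by metis
  qed simp
qed

end
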